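(* For each t2-model $M_{t} = \langle W, \mathfrak{W}, V_{t} \rangle$ there exists an n2-model $M_{\mathcal{N}} = \langle W, \mathcal{N}, V_{\mathcal{N}} \rangle$ (on the same set $W$) which is pointwise equivalent to $M_{t}$, i.e. for every formula $\varphi$ and every $w \in W$: $w \Vdash \varphi$ in $M_{\mathcal{N}}$ if and only if $w \in V_{t}(\varphi)$.
   Context: Language: $PV$ is a fixed denumerable set of propositional variables; formulas are built from propositional variables and $\bot$ using $\land, \lor, \rightarrow$ and the unary operator $\Box$ ($\lnot\varphi$ abbreviates $\varphi \rightarrow \bot$). Complements are written $-A = W \setminus A$. An n2-frame is an ordered pair $\langle W, \mathcal{N} \rangle$ where $W$ is a non-empty set and $\mathcal{N}$ is a function from $W$ into $P(P(W))$ (write $\mathcal{N}_w$ for $\mathcal{N}(w)$) such that, for all $w,u,v \in W$ and $X \subseteq W$: (a) $w \in \bigcap \mathcal{N}_{w}$; (b) $\bigcap \mathcal{N}_{w} \in \mathcal{N}_{w}$; (c) if $u \in \bigcap \mathcal{N}_{w}$ then $\bigcap \mathcal{N}_{u} \subseteq \bigcap \mathcal{N}_{w}$; (d) if $X \subseteq \bigcup \mathcal{N}_{w}$ and $\bigcap \mathcal{N}_{w} \subseteq X$ then $X \in \mathcal{N}_{w}$; (e) if $u \in \bigcap \mathcal{N}_{w}$ then $\bigcup \mathcal{N}_{u} \subseteq \bigcup \mathcal{N}_{w}$; (f) if $v \in \bigcup \mathcal{N}_{w}$ then $\bigcap \mathcal{N}_{v} \subseteq \bigcup \mathcal{N}_{w}$.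 An n2-model is a triple $\langle W, \mathcal{N}, V_{\mathcal{N}} \rangle$ where $\langle W, \mathcal{N} \rangle$ is an n2-frame and $V_{\mathcal{N}} : PV \to P(W)$ satisfies: if $w \in V_{\mathcal{N}}(q)$ then $\bigcap \mathcal{N}_{w} \subseteq V_{\mathcal{N}}(q)$. Forcing in an n2-model is defined inductively: $w \nVdash \bot$; $w \Vdash q \Leftrightarrow w \in V_{\mathcal{N}}(q)$ for $q \in PV$; $w \Vdash \varphi \lor \psi \Leftrightarrow w \Vdash \varphi$ or $w \Vdash \psi$; $w \Vdash \varphi \land \psi \Leftrightarrow w \Vdash \varphi$ and $w \Vdash \psi$; $w \Vdash \varphi \rightarrow \psi \Leftrightarrow \bigcap \mathcal{N}_{w} \subseteq \{v \in W : v \nVdash \varphi \text{ or } v \Vdash \psi\}$; $w \Vdash \Box \varphi \Leftrightarrow \bigcup \mathcal{N}_{w} \subseteq \{v \in W : v \Vdash \varphi\}$. A t2-frame is an ordered pair $\langle W, \mathfrak{W} \rangle$ where $W \neq \emptyset$; $\mathfrak{W}$ is a collection of pairs $\langle T, \tau \rangle$ with $T \subseteq W$ and $\tau$ an Alexandroff topology on $T$ (arbitrary intersections of open sets are open); and every $w \in W$ belongs to $T$ for some $\langle T, \tau \rangle \in \mathfrak{W}$. For $\langle T,\tau\rangle \in \mathfrak{W}$ and $w \in T$, $\mathcal{O}^{w}_{\tau}$ denotes the family of $\tau$-open sets containing $w$, and $\min \mathcal{O}^{w}_{\tau} = \bigcap \mathcal{O}^{w}_{\tau}$. For $w \in W$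 put $\mathcal{T}^{w} = \{\langle T, \tau \rangle \in \mathfrak{W} : w \in T\}$, $m_w = \bigcap_{\langle T, \tau \rangle \in \mathcal{T}^{w}} \min \mathcal{O}^{w}_{\tau}$ and $M_w = \bigcap_{\langle T, \tau\rangle \in \mathcal{T}^{w}} T$. (The paper sets $\mathcal{N}^t_w = \{X : m_w \subseteq X \subseteq M_w\}$ and denotes $m_w$ by $\bigcap \mathcal{N}^{t}_{w}$ and $M_w$ by $\bigcup \mathcal{N}^{t}_{w}$.) A t2-model is a triple $\langle W, \mathfrak{W}, V_{t} \rangle$ where $\langle W, \mathfrak{W} \rangle$ is a t2-frame and $V_{t} : PV \to P(W)$ satisfies: if $w \in V_{t}(q)$ then $m_w \subseteq V_{t}(q)$. The valuation is extended to all formulas inductively: $V_{t}(\bot) = \emptyset$; $V_{t}(\varphi \land \psi) = V_{t}(\varphi) \cap V_{t}(\psi)$; $V_{t}(\varphi \lor \psi) = V_{t}(\varphi) \cup V_{t}(\psi)$; $V_{t}(\varphi \rightarrow \psi) = \bigcup \{ m_w : w \in W,\ m_w \subseteq -V_{t}(\varphi) \cup V_{t}(\psi)\}$; $V_{t}(\Box \varphi) = \bigcup \{ m_w : w \in W,\ M_w \subseteq V_{t}(\varphi)\}$. *)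

theory Defs
  imports "HOL-Analysis.Abstract_Topology"
begin

type_synonym pv = nat

datatype form =
    Bot
  | Var pv
  | And form form
  | Or form form
  | Imp form form
  | Box form


text \<open>The universe \<open>W\<close> is a carrier set, so \<open>\<N>\<close> and the valuations are constrained
  only on \<open>W\<close>. Clause (b) excludes \<open>\<N> w = {}\<close>, where \<open>\<Inter>(\<N> w)\<close> would be \<open>UNIV\<close>.\<close>

definition n2_frame :: "'a set \<Rightarrow> ('a \<Rightarrow> 'a set set) \<Rightarrow> bool" where
  "n2_frame W \<N> \<longleftrightarrow>
     W \<noteq> {} \<and>
     (\<forall>w\<in>W. \<N> w \<subseteq> Pow W) \<and>
     (\<forall>w\<in>W. w \<in> \<Inter>(\<N> w)) \<and>
     (\<forall>w\<in>W. \<Inter>(\<N> w) \<in> \<N> w) \<and>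
     (\<forall>w\<in>W. \<forall>u\<in>W. u \<in> \<Inter>(\<N> w) \<longrightarrow> \<Inter>(\<N> u) \<subseteq> \<Inter>(\<N> w)) \<and>
     (\<forall>w\<in>W. \<forall>X. X \<subseteq> W \<longrightarrow> X \<subseteq> \<Union>(\<N> w) \<and> \<Inter>(\<N> w) \<subseteq> X \<longrightarrow> X \<in> \<N> w) \<and>
     (\<forall>w\<in>W. \<forall>u\<in>W. u \<in> \<Inter>(\<N> w) \<longrightarrow> \<Union>(\<N> u) \<subseteq> \<Union>(\<N> w)) \<and>
     (\<forall>w\<in>W. \<forall>v\<in>W. v \<in> \<Union>(\<N> w) \<longrightarrow> \<Inter>(\<N> v) \<subseteq> \<Union>(\<N> w))"

definition n2_model :: "'a set \<Rightarrow> ('a \<Rightarrow> 'a set set) \<Rightarrow> (pv \<Rightarrow> 'a set) \<Rightarrow> bool" where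
  "n2_model W \<N> V \<longleftrightarrow>
     n2_frame W \<N> \<and>
     (\<forall>q. V q \<subseteq> W) \<and>
     (\<forall>q. \<forall>w\<in>W. w \<in> V q \<longrightarrow> \<Inter>(\<N> w) \<subseteq> V q)"

primrec n2_forces ::
  "'a set \<Rightarrow> ('a \<Rightarrow> 'a set set) \<Rightarrow> (pv \<Rightarrow> 'a set) \<Rightarrow> 'a \<Rightarrow> form \<Rightarrow> bool" where
  "n2_forces W \<N> V w Bot \<longleftrightarrow> False"
| "n2_forces W \<N> V w (Var q) \<longleftrightarrow> w \<in> V q"
| "n2_forces W \<N> V w (And \<phi> \<psi>) \<longleftrightarrow> n2_forces W \<N> V w \<phi> \<and> n2_forces W \<N> V w \<psi>"
| "n2_forces W \<N> V w (Or \<phi> \<psi>) \<longleftrightarrow> n2_forces W \<N> V w \<phi> \<or> n2_forces W \<N> V w \<psi>"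
| "n2_forces W \<N> V w (Imp \<phi> \<psi>) \<longleftrightarrow>
     \<Inter>(\<N> w) \<subseteq> {v \<in> W. \<not> n2_forces W \<N> V v \<phi> \<or> n2_forces W \<N> V v \<psi>}"
| "n2_forces W \<N> V w (Box \<phi>) \<longleftrightarrow> \<Union>(\<N> w) \<subseteq> {v \<in> W. n2_forces W \<N> V v \<phi>}"


text \<open>Only nonempty families are required: the empty intersection within the space is the
  space itself, whereas \<open>\<Inter>{}\<close> is \<open>UNIV\<close>.\<close>

definition alexandroff_space :: "'a topology \<Rightarrow> bool" where
  "alexandroff_space \<tau> \<longleftrightarrow>
     (\<forall>\<U>. \<U> \<noteq> {} \<longrightarrow> (\<forall>U\<in>\<U>. openin \<tau> U) \<longrightarrow> openin \<tau> (\<Inter>\<U>))"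

definition t2_frame :: "'a set \<Rightarrow> ('a set \<times> 'a topology) set \<Rightarrow> bool" where
  "t2_frame W \<WW> \<longleftrightarrow>
     W \<noteq> {} \<and>
     (\<forall>(T, \<tau>)\<in>\<WW>. T \<subseteq> W \<and> topspace \<tau> = T \<and> alexandroff_space \<tau>) \<and>
     (\<forall>w\<in>W. \<exists>(T, \<tau>)\<in>\<WW>. w \<in> T)"

definition open_nbhds :: "'a topology \<Rightarrow> 'a \<Rightarrow> 'a set set" where
  "open_nbhds \<tau> w = {U. openin \<tau> U \<and> w \<in> U}"

definition t2_at :: "('a set \<times> 'a topology) set \<Rightarrow> 'a \<Rightarrow> ('a set \<times> 'a topology) set" where
  "t2_at \<WW> w = {(T, \<tau>) \<in> \<WW>. w \<in> T}"

definition t2_min :: "('a set \<times> 'a topology) set \<Rightarrow> 'a \<Rightarrow> 'a set" where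
  "t2_min \<WW> w = (\<Inter>(T, \<tau>)\<in>t2_at \<WW> w. \<Inter>(open_nbhds \<tau> w))"

definition t2_max :: "('a set \<times> 'a topology) set \<Rightarrow> 'a \<Rightarrow> 'a set" where
  "t2_max \<WW> w = (\<Inter>(T, \<tau>)\<in>t2_at \<WW> w. T)"

definition t2_model ::
  "'a set \<Rightarrow> ('a set \<times> 'a topology) set \<Rightarrow> (pv \<Rightarrow> 'a set) \<Rightarrow> bool" where
  "t2_model W \<WW> V \<longleftrightarrow>
     t2_frame W \<WW> \<and>
     (\<forall>q. V q \<subseteq> W) \<and>
     (\<forall>q. \<forall>w\<in>W. w \<in> V q \<longrightarrow> t2_min \<WW> w \<subseteq> V q)"

primrec t2_val ::
  "'a set \<Rightarrow> ('a set \<times> 'a topology) set \<Rightarrow> (pv \<Rightarrow> 'a set) \<Rightarrow> form \<Rightarrow> 'a set" where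
  "t2_val W \<WW> V Bot = {}"
| "t2_val W \<WW> V (Var q) = V q"
| "t2_val W \<WW> V (And \<phi> \<psi>) = t2_val W \<WW> V \<phi> \<inter> t2_val W \<WW> V \<psi>"
| "t2_val W \<WW> V (Or \<phi> \<psi>) = t2_val W \<WW> V \<phi> \<union> t2_val W \<WW> V \<psi>"
| "t2_val W \<WW> V (Imp \<phi> \<psi>) =
     \<Union>{t2_min \<WW> w | w. w \<in> W \<and> t2_min \<WW> w \<subseteq> (W - t2_val W \<WW> V \<phi>) \<union> t2_val W \<WW> V \<psi>}"
| "t2_val W \<WW> V (Box \<phi>) =
     \<Union>{t2_min \<WW> w | w. w \<in> W \<and> t2_max \<WW> w \<subseteq> t2_val W \<WW> V \<phi>}"

end

theory Submission
  imports Defs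
begin

text \<open>
  An n2-frame only matters through two sets per world, the least neighbourhood \<open>\<Inter>(\<N> w)\<close> and
  the greatest one \<open>\<Union>(\<N> w)\<close>: the forcing clauses mention nothing else. A t2-frame also
  attaches two sets to a world, \<open>m\<^sub>w\<close> (\<open>t2_min\<close>) and \<open>M\<^sub>w\<close> (\<open>t2_max\<close>), so the n2-model takes
  all sets between \<open>m\<^sub>w\<close> and \<open>M\<^sub>w\<close> as neighbourhoods of \<open>w\<close> and keeps the valuation.

  What makes this work is that passing from \<open>w\<close> to a world \<open>u \<in> M\<^sub>w\<close> can only increase the
  collection of spaces over which the intersections are formed (\<open>t2_at_mono\<close>). Hence \<open>u \<in> m\<^sub>w\<close>
  implies \<open>m\<^sub>u \<subseteq> m\<^sub>w\<close> and \<open>M\<^sub>u \<subseteq> M\<^sub>w\<close>, and \<open>v \<in> M\<^sub>w\<close> implies \<open>m\<^sub>v \<subseteq> M\<^sub>w\<close>; these are the frame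
  conditions. The two semantics differ only in that the topological one closes the value of an
  implication or a box under \<open>m\<close>. This closure adds nothing: whenever the defining condition
  holds at \<open>u\<close> and \<open>w \<in> m\<^sub>u\<close>, the same two inclusions carry the condition over to \<open>w\<close>. The
  equivalence then follows by induction on the formula.
\<close>

definition neighbourhoods_between :: "'a set \<Rightarrow> 'a set \<Rightarrow> 'a set set" where
  "neighbourhoods_between A B = {X. A \<subseteq> X \<and> X \<subseteq> B}"

lemma Inter_neighbourhoods_between: "A \<subseteq> B \<Longrightarrow> \<Inter>(neighbourhoods_between A B) = A"
  by (auto simp: neighbourhoods_between_def)

lemma Union_neighbourhoods_between: "A \<subseteq> B \<Longrightarrow> \<Union>(neighbourhoods_between A B) = B"
  by (auto simp: neighbourhoods_between_def)

lemma t2_at_mono: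
  assumes "u \<in> t2_max \<WW> w"
  shows "t2_at \<WW> w \<subseteq> t2_at \<WW> u"
  using assms by (auto simp: t2_max_def t2_at_def)

lemma t2_max_mono:
  assumes "u \<in> t2_max \<WW> w"
  shows "t2_max \<WW> u \<subseteq> t2_max \<WW> w"
  using t2_at_mono[OF assms] unfolding t2_max_def by blast

lemma mem_t2_min: "w \<in> t2_min \<WW> w"
  by (auto simp: t2_min_def open_nbhds_def)

lemma t2_max_subset_carrier:
  assumes "t2_frame W \<WW>" and "w \<in> W"
  shows "t2_max \<WW> w \<subseteq> W"
proof -
  obtain T \<tau> where "(T, \<tau>) \<in> \<WW>" and "w \<in> T"
    using assms unfolding t2_frame_def by fast
  then have "t2_max \<WW> w \<subseteq> T"
    by (auto simp: t2_max_def t2_at_def)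
  also have "T \<subseteq> W"
    using assms(1) \<open>(T, \<tau>) \<in> \<WW>\<close> by (auto simp: t2_frame_def)
  finally show ?thesis .
qed

text \<open>Each space \<open>T\<close> is an open neighbourhood of its points, so it takes part in the
  intersection defining \<open>m\<^sub>w\<close>.\<close>

lemma t2_min_subset_max:
  assumes "t2_frame W \<WW>"
  shows "t2_min \<WW> w \<subseteq> t2_max \<WW> w"
proof
  fix x assume x: "x \<in> t2_min \<WW> w"
  have "x \<in> T" if "(T, \<tau>) \<in> t2_at \<WW> w" for T \<tau>
  proof -
    have "topspace \<tau> = T" "w \<in> T"
      using that assms by (auto simp: t2_at_def t2_frame_def)
    then have "T \<in> open_nbhds \<tau> w"
      by (auto simp: open_nbhds_def)
    then show ?thesis
      using x that by (auto simp: t2_min_def)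
  qed
  then show "x \<in> t2_max \<WW> w"
    by (auto simp: t2_max_def)
qed

text \<open>Besides ranging over more spaces, the intersection at \<open>u\<close> uses more open sets in each
  space shared with \<open>w\<close>: every open set around \<open>w\<close> contains \<open>m\<^sub>w\<close>, hence \<open>u\<close>.\<close>

lemma t2_min_mono:
  assumes frame: "t2_frame W \<WW>" and u: "u \<in> t2_min \<WW> w"
  shows "t2_min \<WW> u \<subseteq> t2_min \<WW> w"
proof
  fix x assume x: "x \<in> t2_min \<WW> u"
  have at: "t2_at \<WW> w \<subseteq> t2_at \<WW> u"
    using t2_min_subset_max[OF frame] u by (intro t2_at_mono) auto
  have "x \<in> U" if "(T, \<tau>) \<in> t2_at \<WW> w" and "U \<in> open_nbhds \<tau> w" for T \<tau> U
  proof -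
    have "u \<in> U"
      using u that by (auto simp: t2_min_def)
    then have "U \<in> open_nbhds \<tau> u"
      using that(2) by (simp add: open_nbhds_def)
    moreover have "(T, \<tau>) \<in> t2_at \<WW> u"
      using at that(1) by (rule subsetD)
    ultimately show ?thesis
      using x by (auto simp: t2_min_def)
  qed
  then show "x \<in> t2_min \<WW> w"
    by (auto simp: t2_min_def)
qed

lemma n2_model_of_t2_model:
  assumes "t2_model W \<WW> V"
  shows "n2_model W (\<lambda>w. neighbourhoods_between (t2_min \<WW> w) (t2_max \<WW> w)) V"
proof -
  have frame: "t2_frame W \<WW>"
    using assms by (simp add: t2_model_def)
  note min_max = t2_min_subset_max[OF frame]
  note Inter = Inter_neighbourhoods_between[OF min_max]
  note Union = Union_neighbourhoods_between[OF min_max]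
  have "n2_frame W (\<lambda>w. neighbourhoods_between (t2_min \<WW> w) (t2_max \<WW> w))"
    unfolding n2_frame_def Inter Union
  proof (intro conjI ballI allI impI)
    show "W \<noteq> {}"
      using frame by (simp add: t2_frame_def)
  next
    fix w assume "w \<in> W"
    then show "neighbourhoods_between (t2_min \<WW> w) (t2_max \<WW> w) \<subseteq> Pow W"
      using t2_max_subset_carrier[OF frame] by (auto simp: neighbourhoods_between_def)
  next
    fix w show "w \<in> t2_min \<WW> w"
      by (rule mem_t2_min)
  next
    fix w show "t2_min \<WW> w \<in> neighbourhoods_between (t2_min \<WW> w) (t2_max \<WW> w)"
      using min_max by (simp add: neighbourhoods_between_def)
  next
    fix w u assume "u \<in> t2_min \<WW> w"
    then show "t2_min \<WW> u \<subseteq> t2_min \<WW> w"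
      by (rule t2_min_mono[OF frame])
  next
    fix w X assume "X \<subseteq> t2_max \<WW> w \<and> t2_min \<WW> w \<subseteq> X"
    then show "X \<in> neighbourhoods_between (t2_min \<WW> w) (t2_max \<WW> w)"
      by (simp add: neighbourhoods_between_def)
  next
    fix w u assume "u \<in> t2_min \<WW> w"
    then show "t2_max \<WW> u \<subseteq> t2_max \<WW> w"
      using min_max by (intro t2_max_mono) (rule subsetD)
  next
    fix w v assume "v \<in> t2_max \<WW> w"
    then show "t2_min \<WW> v \<subseteq> t2_max \<WW> w"
      by (intro subset_trans[OF min_max t2_max_mono])
  qed
  then show ?thesis
    using assms by (simp add: n2_model_def t2_model_def Inter)
qed

text \<open>If the condition on \<open>u\<close> holds and \<open>w \<in> m\<^sub>u\<close>, then \<open>m\<^sub>w \<subseteq> m\<^sub>u\<close> passes it on to \<open>w\<close>.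
  So the union over \<open>u\<close> can be replaced by the condition on \<open>w\<close> itself, the form that the
  forcing clause has; for boxes \<open>M\<^sub>w \<subseteq> M\<^sub>u\<close> does the same.\<close>

lemma mem_t2_val_Imp_iff:
  assumes frame: "t2_frame W \<WW>" and "w \<in> W"
  shows "w \<in> t2_val W \<WW> V (Imp \<phi> \<psi>) \<longleftrightarrow>
    t2_min \<WW> w \<subseteq> (W - t2_val W \<WW> V \<phi>) \<union> t2_val W \<WW> V \<psi>"
proof
  assume "w \<in> t2_val W \<WW> V (Imp \<phi> \<psi>)"
  then obtain u where "w \<in> t2_min \<WW> u"
    and "t2_min \<WW> u \<subseteq> (W - t2_val W \<WW> V \<phi>) \<union> t2_val W \<WW> V \<psi>"
    by auto
  then show "t2_min \<WW> w \<subseteq> (W - t2_val W \<WW> V \<phi>) \<union> t2_val W \<WW> V \<psi>"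
    using t2_min_mono[OF frame, of w u] by (meson subset_trans)
next
  assume "t2_min \<WW> w \<subseteq> (W - t2_val W \<WW> V \<phi>) \<union> t2_val W \<WW> V \<psi>"
  then show "w \<in> t2_val W \<WW> V (Imp \<phi> \<psi>)"
    using \<open>w \<in> W\<close> mem_t2_min[of w \<WW>] by auto
qed

lemma mem_t2_val_Box_iff:
  assumes frame: "t2_frame W \<WW>" and "w \<in> W"
  shows "w \<in> t2_val W \<WW> V (Box \<phi>) \<longleftrightarrow> t2_max \<WW> w \<subseteq> t2_val W \<WW> V \<phi>"
proof
  assume "w \<in> t2_val W \<WW> V (Box \<phi>)"
  then obtain u where "w \<in> t2_min \<WW> u" and "t2_max \<WW> u \<subseteq> t2_val W \<WW> V \<phi>"
    by auto
  then show "t2_max \<WW> w \<subseteq> t2_val W \<WW> V \<phi>"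
    using t2_max_mono[of w \<WW> u] t2_min_subset_max[OF frame, of u] by (meson subset_iff)
next
  assume "t2_max \<WW> w \<subseteq> t2_val W \<WW> V \<phi>"
  then show "w \<in> t2_val W \<WW> V (Box \<phi>)"
    using \<open>w \<in> W\<close> mem_t2_min[of w \<WW>] by auto
qed

lemma n2_forces_iff_mem_t2_val:
  assumes frame: "t2_frame W \<WW>" and "w \<in> W"
  shows "n2_forces W (\<lambda>w. neighbourhoods_between (t2_min \<WW> w) (t2_max \<WW> w)) V w \<phi> \<longleftrightarrow>
    w \<in> t2_val W \<WW> V \<phi>"
  using \<open>w \<in> W\<close>
proof (induction \<phi> arbitrary: w)
  case (Imp \<phi> \<psi>)
  have "t2_min \<WW> w \<subseteq> W"
    using t2_min_subset_max[OF frame] t2_max_subset_carrier[OF frame Imp.prems]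
    by (rule subset_trans)
  then show ?case
    using Imp.IH
    unfolding mem_t2_val_Imp_iff[OF frame Imp.prems] n2_forces.simps
      Inter_neighbourhoods_between[OF t2_min_subset_max[OF frame]]
    by blast
next
  case (Box \<phi>)
  then show ?case
    using t2_max_subset_carrier[OF frame Box.prems]
    unfolding mem_t2_val_Box_iff[OF frame Box.prems] n2_forces.simps
      Union_neighbourhoods_between[OF t2_min_subset_max[OF frame]]
    by blast
qed simp_all

theorem theorem7p6:
  fixes W :: "'a set"
    and \<WW> :: "('a set \<times> 'a topology) set"
    and V\<^sub>t :: "pv \<Rightarrow> 'a set"
  assumes "t2_model W \<WW> V\<^sub>t"
  shows "\<exists>(\<N> :: 'a \<Rightarrow> 'a set set) (V\<^sub>\<N> :: pv \<Rightarrow> 'a set).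
           n2_model W \<N> V\<^sub>\<N> \<and>
           (\<forall>\<phi>. \<forall>w\<in>W. n2_forces W \<N> V\<^sub>\<N> w \<phi> \<longleftrightarrow> w \<in> t2_val W \<WW> V\<^sub>t \<phi>)"
proof (intro exI conjI allI ballI)
  show "n2_model W (\<lambda>w. neighbourhoods_between (t2_min \<WW> w) (t2_max \<WW> w)) V\<^sub>t"
    using assms by (rule n2_model_of_t2_model)
next
  fix \<phi> w assume "w \<in> W"
  moreover have "t2_frame W \<WW>"
    using assms by (simp add: t2_model_def)
  ultimately show "n2_forces W (\<lambda>w. neighbourhoods_between (t2_min \<WW> w) (t2_max \<WW> w)) V\<^sub>t w \<phi> \<longleftrightarrow>
      w \<in> t2_val W \<WW> V\<^sub>t \<phi>"
    by (intro n2_forces_iff_mem_t2_val)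
qed

end
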